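(* For all positive integers $n$ and $k$, the over-Mahonian numbers satisfy the recurrence relation $$i_{B'}(n,k) = i_{B'}(n-1,k) + 2 \sum_{j=1}^{n-1} i_{B'}(n-1,k-j),$$ with the initial conditions $i_{B'}(n,0) = 1$ and $i_{B'}(n,k) = 0$ unless $0 \leq k \leq \binom{n}{2}$.
   Context: For $n\ge 1$, $B'_n$ denotes the set of overlined permutations of $\{1,\dots,n\}$ of the following kind: an element is a permutation $\sigma=\sigma_1\sigma_2\cdots\sigma_n$ of $\{1,\dots,n\}$ (in one-line notation) in which each entry $\sigma_i$ is independently either overlined or not overlined, subject to the condition that $\sigma_i$ may be overlined only if there is an index $j>i$ with $\sigma_i>\sigma_j$ (overlines are ignored in comparing entries). An inversion of such an element is a pair of positions $i<j$ with $\sigma_i>\sigma_j$, again ignoring overlines. The over-Mahonian number $i_{B'}(n,k)$ is the number of elements of $B'_n$ with exactly $k$ inversions; it is $0$ for integers $k$ outside $0\le k\le\binom n2$. For $n=0$ the convention is $i_{B'}(0,0)=1$ and $i_{B'}(0,k)=0$ for $k\neq 0$. *)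

theory Defs
  imports Main "HOL-Combinatorics.Multiset_Permutations"
begin

text \<open>
  An overlined permutation is a list of pairs \<open>(v, b)\<close> in one-line notation: \<open>v\<close> is the
  entry and \<open>b\<close> says whether it is overlined. Positions are counted from \<open>0\<close>.
\<close>

definition overlined_perms :: "nat \<Rightarrow> (nat \<times> bool) list set" where
  "overlined_perms n =
     {xs. map fst xs \<in> permutations_of_set {1..n} \<and>
          (\<forall>i<length xs. snd (xs ! i) \<longrightarrow>
             (\<exists>j<length xs. i < j \<and> fst (xs ! i) > fst (xs ! j)))}"

definition inversions :: "(nat \<times> bool) list \<Rightarrow> (nat \<times> nat) set" where
  "inversions xs = {(i, j). i < j \<and> j < length xs \<and> fst (xs ! i) > fst (xs ! j)}"

text \<open>The second argument is an integer, so that differences in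
  that position are not truncated at \<open>0\<close>.\<close>

definition over_mahonian :: "nat \<Rightarrow> int \<Rightarrow> nat" where
  "over_mahonian n k = card {xs \<in> overlined_perms n. int (card (inversions xs)) = k}"

text \<open>\<open>card\<close> of an infinite set would be \<open>0\<close>; the sets counted here are finite.\<close>

lemma finite_overlined_perms: "finite (overlined_perms n)"
proof (rule finite_subset)
  show "overlined_perms n \<subseteq> {xs. set xs \<subseteq> {1..n} \<times> UNIV \<and> length xs = n}"
  proof
    fix xs assume "xs \<in> overlined_perms n"
    then have *: "map fst xs \<in> permutations_of_set {1..n}"
      by (simp add: overlined_perms_def)
    then have "length xs = n"
      using length_finite_permutations_of_set[OF *] by simp
    moreover have "fst ` set xs = {1..n}"
      using permutations_of_setD(1)[OF *] by simp
    then have "set xs \<subseteq> {1..n} \<times> UNIV"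
      by (metis mem_Times_iff UNIV_I imageI subsetI)
    ultimately show "xs \<in> {xs. set xs \<subseteq> {1..n} \<times> UNIV \<and> length xs = n}"
      by simp
  qed
  show "finite {xs. set xs \<subseteq> {1..n} \<times> (UNIV :: bool set) \<and> length xs = n}"
    by (rule finite_lists_length_eq) simp
qed

text \<open>The convention for \<open>n = 0\<close> is the general definition applied to the empty list.\<close>

lemma over_mahonian_0: "over_mahonian 0 k = (if k = 0 then 1 else 0)"
proof -
  have "overlined_perms 0 = {[]}"
    by (auto simp: overlined_perms_def)
  moreover have "inversions [] = {}"
    by (auto simp: inversions_def)
  ultimately have "{xs \<in> overlined_perms 0. int (card (inversions xs)) = k} =
      (if k = 0 then {[]} else {})"
    by auto
  then show ?thesis
    by (simp add: over_mahonian_def)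
qed

end

theory Submission
  imports Defs
begin

text \<open>
  Delete the largest entry \<open>n + 1\<close> from an overlined permutation of \<open>{1..n + 1}\<close>. If it has \<open>q\<close>
  entries to its right, it is the larger member of exactly \<open>q\<close> inversions and the smaller member of
  none, so the deletion lowers the number of inversions by exactly \<open>q\<close>. The deletion does not affect
  which of the other entries may be overlined, because \<open>n + 1\<close> is never the smaller entry that
  justifies an overline. The entry \<open>n + 1\<close> itself may be overlined precisely when \<open>q > 0\<close>. Hence an
  overlined permutation of \<open>{1..n + 1}\<close> is the same as one of \<open>{1..n}\<close> together with a pair \<open>(q, b)\<close>,
  where \<open>q \<le> n\<close> and the overline mark \<open>b\<close> is free for \<open>q > 0\<close> and must be absent for \<open>q = 0\<close>
  (lemma \<open>bij_betw_insert_max\<close>). Counting by inversions gives the term for \<open>q = 0\<close> once and each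
  term for \<open>1 \<le> q \<le> n\<close> twice, which is the recurrence.

  The argument works for every integer \<open>k\<close> (lemma \<open>over_mahonian_Suc\<close>), so the values at \<open>k = 0\<close>
  and the vanishing above \<open>n choose 2\<close> follow from the recurrence by induction on \<open>n\<close>.
\<close>

section \<open>Inversions and overlines by recursion on lists\<close>

text \<open>
  The definitions by positions are awkward when an entry is inserted in the middle of a list, since
  all later positions shift. The two functions below reformulate them entry by entry.
\<close>

fun inv_count :: "(nat \<times> bool) list \<Rightarrow> nat" where
  "inv_count [] = 0"
| "inv_count (x # xs) = length (filter (\<lambda>y. fst y < fst x) xs) + inv_count xs"

fun overlines_ok :: "(nat \<times> bool) list \<Rightarrow> bool" where
  "overlines_ok [] \<longleftrightarrow> True"
| "overlines_ok (x # xs) \<longleftrightarrow> (snd x \<longrightarrow> (\<exists>y\<in>set xs. fst y < fst x)) \<and> overlines_ok xs"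

lemma finite_inversions: "finite (inversions xs)"
  by (rule finite_subset[of _ "{..<length xs} \<times> {..<length xs}"]) (auto simp: inversions_def)

text \<open>
  The inversions of \<open>x # xs\<close> are those with first position \<open>0\<close>, one for each smaller entry of \<open>xs\<close>,
  and those of \<open>xs\<close> with both positions shifted by one.
\<close>

lemma card_inversions: "card (inversions xs) = inv_count xs"
proof (induction xs)
  case Nil
  have "inversions [] = {}" by (auto simp: inversions_def)
  then show ?case by simp
next
  case (Cons x xs)
  let ?A = "(\<lambda>j. (0, Suc j)) ` {j. j < length xs \<and> fst (xs ! j) < fst x}"
  let ?B = "map_prod Suc Suc ` inversions xs"
  have "p \<in> inversions (x # xs) \<longleftrightarrow> p \<in> ?A \<union> ?B" for p
  proof (cases p)
    case (Pair i j)
    then show ?thesis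
      by (cases i; cases j) (auto simp: inversions_def image_iff)
  qed
  then have "inversions (x # xs) = ?A \<union> ?B" by blast
  moreover have "?A \<inter> ?B = {}" by auto
  moreover have "card ?A = length (filter (\<lambda>y. fst y < fst x) xs)"
    by (subst card_image) (auto simp: inj_on_def length_filter_conv_card)
  moreover have "card ?B = inv_count xs"
    using Cons.IH by (subst card_image) (auto simp: inj_on_def)
  ultimately show ?case
    by (simp add: card_Un_disjoint finite_inversions)
qed

lemma overlines_ok_iff:
  "overlines_ok xs \<longleftrightarrow>
     (\<forall>i<length xs. snd (xs ! i) \<longrightarrow> (\<exists>j<length xs. i < j \<and> fst (xs ! i) > fst (xs ! j)))"
proof (induction xs)
  case Nil
  show ?case by simp
next
  case (Cons x xs)
  have "(\<exists>y\<in>set xs. fst y < fst x) \<longleftrightarrow> (\<exists>j<length xs. fst (xs ! j) < fst x)"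
    by (metis in_set_conv_nth)
  then show ?case
    by (simp only: overlines_ok.simps Cons.IH list.size add_Suc_right add_0_right
        All_less_Suc2 Ex_less_Suc2 nth_Cons_0 nth_Cons_Suc)
       simp
qed

lemma overlined_perms_iff:
  "xs \<in> overlined_perms n \<longleftrightarrow>
     fst ` set xs = {1..n} \<and> distinct (map fst xs) \<and> overlines_ok xs"
  by (auto simp: overlined_perms_def overlines_ok_iff permutations_of_set_def)

lemma length_overlined_perms:
  assumes "xs \<in> overlined_perms n"
  shows "length xs = n"
proof -
  have "card (set (map fst xs)) = n" "distinct (map fst xs)"
    using assms by (simp_all add: overlined_perms_iff)
  then show ?thesis
    using distinct_card by fastforce
qed

section \<open>Inserting the largest entry\<close>

lemma inv_count_insert_max:
  assumes "\<forall>y\<in>set (us @ vs). fst y < m"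
  shows "inv_count (us @ (m, b) # vs) = length vs + inv_count (us @ vs)"
  using assms by (induction us) auto

lemma overlines_ok_insert_max:
  assumes "\<forall>y\<in>set (us @ vs). fst y < m"
  shows "overlines_ok (us @ (m, b) # vs) \<longleftrightarrow> (b \<longrightarrow> vs \<noteq> []) \<and> overlines_ok (us @ vs)"
  using assms
proof (induction us)
  case Nil
  then show ?case by (cases vs) auto
next
  case (Cons u us)
  then show ?case by auto
qed

lemma insert_max_overlined_perms_iff:
  assumes "Suc n \<notin> fst ` set (us @ vs)"
  shows "us @ (Suc n, b) # vs \<in> overlined_perms (Suc n) \<longleftrightarrow>
    (b \<longrightarrow> vs \<noteq> []) \<and> us @ vs \<in> overlined_perms n"
proof -
  have "{1..Suc n} = insert (Suc n) {1..n}" by auto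
  with assms have set_iff:
    "fst ` set (us @ (Suc n, b) # vs) = {1..Suc n} \<longleftrightarrow> fst ` set (us @ vs) = {1..n}"
    by (auto simp: insert_ident)
  have distinct_iff:
    "distinct (map fst (us @ (Suc n, b) # vs)) \<longleftrightarrow> distinct (map fst (us @ vs))"
    using assms by (auto simp: image_Un)
  show ?thesis
  proof (cases "fst ` set (us @ vs) = {1..n}")
    case True
    then have "\<forall>y\<in>set (us @ vs). fst y < Suc n" by (auto dest!: equalityD1)
    then show ?thesis
      unfolding overlined_perms_iff set_iff distinct_iff
      by (subst overlines_ok_insert_max) blast+
  next
    case False
    with set_iff show ?thesis unfolding overlined_perms_iff by blast
  qed
qed

text \<open>
  The place of insertion is recorded by the number \<open>q\<close> of entries to its right, because this is the
  number of inversions gained.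
\<close>

definition insert_max :: "nat \<Rightarrow> (nat \<times> bool) \<times> (nat \<times> bool) list \<Rightarrow> (nat \<times> bool) list" where
  "insert_max n = (\<lambda>((q, b), ys). take (n - q) ys @ (Suc n, b) # drop (n - q) ys)"

definition max_places :: "nat \<Rightarrow> (nat \<times> bool) set" where
  "max_places n = {(q, b). q \<le> n \<and> (b \<longrightarrow> q > 0)}"

definition overlined_perms_inv :: "nat \<Rightarrow> int \<Rightarrow> (nat \<times> bool) list set" where
  "overlined_perms_inv n k = {xs \<in> overlined_perms n. int (inv_count xs) = k}"

lemma over_mahonian_eq_card: "over_mahonian n k = card (overlined_perms_inv n k)"
  by (simp add: over_mahonian_def overlined_perms_inv_def card_inversions)

lemma Suc_notin_overlined_perms: "ys \<in> overlined_perms n \<Longrightarrow> Suc n \<notin> fst ` set ys"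
  by (simp add: overlined_perms_iff)

lemma less_Suc_overlined_perms: "ys \<in> overlined_perms n \<Longrightarrow> \<forall>y\<in>set ys. fst y < Suc n"
  by (auto simp: overlined_perms_iff dest!: equalityD1)

text \<open>
  Insertion is injective because the entry \<open>Suc n\<close> occurs only once, so its position and its mark can
  be read off from the result; it is surjective because \<open>Suc n\<close> does occur and can be deleted.
\<close>

lemma bij_betw_insert_max:
  "bij_betw (insert_max n)
     (SIGMA (q, b) : max_places n. overlined_perms_inv n (k - int q))
     (overlined_perms_inv (Suc n) k)"
  (is "bij_betw _ ?D _")
proof (rule bij_betwI')
  fix x y assume "x \<in> ?D" "y \<in> ?D"
  then obtain q b ys q' b' ys' where x: "x = ((q, b), ys)" and y: "y = ((q', b'), ys')"
    and mem: "ys \<in> overlined_perms n" "ys' \<in> overlined_perms n" and q: "q \<le> n" "q' \<le> n"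
    by (auto simp: max_places_def overlined_perms_inv_def)
  note len = mem[THEN length_overlined_perms]
  show "insert_max n x = insert_max n y \<longleftrightarrow> x = y"
  proof
    assume eq: "insert_max n x = insert_max n y"
    have "Suc n \<notin> set (map fst (take (n - q) ys))" "Suc n \<notin> set (map fst (drop (n - q) ys))"
      using Suc_notin_overlined_perms[OF mem(1)] by (auto dest: in_set_takeD in_set_dropD)
    \<comment> \<open>The marks may differ a priori, so the position of \<open>Suc n\<close> is compared after erasing them.\<close>
    moreover have "map fst (take (n - q) ys) @ Suc n # map fst (drop (n - q) ys) =
        map fst (take (n - q') ys') @ Suc n # map fst (drop (n - q') ys')"
      using arg_cong[OF eq, of "map fst"] by (simp add: x y insert_max_def)
    ultimately have "map fst (take (n - q) ys) = map fst (take (n - q') ys')"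
      by (simp add: append_Cons_eq_iff)
    then have len': "length (take (n - q) ys) = length (take (n - q') ys')"
      by (rule map_eq_imp_length_eq)
    then have "q = q'" using len q by simp
    moreover have "take (n - q) ys = take (n - q') ys'" "b = b'"
      "drop (n - q) ys = drop (n - q') ys'"
      using eq len' by (simp_all add: x y insert_max_def)
    moreover from this have "ys = ys'"
      by (metis append_take_drop_id)
    ultimately show "x = y"
      by (simp add: x y)
  qed simp
next
  fix x assume "x \<in> ?D"
  then obtain q b ys where x: "x = ((q, b), ys)" and mem: "ys \<in> overlined_perms n"
    and q: "q \<le> n" "b \<longrightarrow> q > 0" and k: "int (inv_count ys) = k - int q"
    by (auto simp: max_places_def overlined_perms_inv_def)
  let ?us = "take (n - q) ys" and ?vs = "drop (n - q) ys"
  have len: "length ?vs = q" using length_overlined_perms[OF mem] q by simp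
  then have ne: "b \<longrightarrow> ?vs \<noteq> []" using q(2) by (metis list.size(3) less_irrefl)
  have "?us @ (Suc n, b) # ?vs \<in> overlined_perms (Suc n)"
    using Suc_notin_overlined_perms[OF mem] mem ne
    by (subst insert_max_overlined_perms_iff) simp_all
  moreover have "inv_count (?us @ (Suc n, b) # ?vs) = q + inv_count ys"
    using inv_count_insert_max[of ?us ?vs "Suc n" b] less_Suc_overlined_perms[OF mem] len by simp
  ultimately show "insert_max n x \<in> overlined_perms_inv (Suc n) k"
    using k by (simp add: x insert_max_def overlined_perms_inv_def)
next
  fix xs assume "xs \<in> overlined_perms_inv (Suc n) k"
  then have mem: "xs \<in> overlined_perms (Suc n)" and k: "int (inv_count xs) = k"
    by (auto simp: overlined_perms_inv_def)
  from mem have "Suc n \<in> fst ` set xs" by (simp add: overlined_perms_iff)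
  then obtain b where "(Suc n, b) \<in> set xs" by auto
  then obtain us vs where xs: "xs = us @ (Suc n, b) # vs" by (meson split_list)
  have "Suc n \<notin> fst ` set (us @ vs)" using mem by (auto simp: xs overlined_perms_iff)
  then have ys: "us @ vs \<in> overlined_perms n" and b: "b \<longrightarrow> vs \<noteq> []"
    using mem insert_max_overlined_perms_iff by (simp_all add: xs)
  have len: "length us + length vs = n" using length_overlined_perms[OF ys] by simp
  have "inv_count xs = length vs + inv_count (us @ vs)"
    unfolding xs by (rule inv_count_insert_max[OF less_Suc_overlined_perms[OF ys]])
  then have "((length vs, b), us @ vs) \<in> ?D"
    using ys b k len by (auto simp: max_places_def overlined_perms_inv_def)
  moreover have "xs = insert_max n ((length vs, b), us @ vs)"
    using len by (auto simp: insert_max_def xs)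
  ultimately show "\<exists>x\<in>?D. xs = insert_max n x" by blast
qed

section \<open>The recurrence and its consequences\<close>

lemma sum_max_places:
  fixes f :: "nat \<Rightarrow> nat"
  shows "(\<Sum>(q, b)\<in>max_places n. f q) = f 0 + 2 * (\<Sum>q=1..n. f q)"
proof -
  have eq: "max_places n = insert (0, False) ({1..n} \<times> UNIV)"
    by (auto simp: max_places_def)
  have "(\<Sum>(q, b)\<in>{1..n} \<times> (UNIV :: bool set). f q) = 2 * (\<Sum>q=1..n. f q)"
    by (simp add: sum.cartesian_product[symmetric] sum_distrib_left)
  then show ?thesis by (simp add: eq)
qed

lemma over_mahonian_Suc:
  "over_mahonian (Suc n) k =
     over_mahonian n k + 2 * (\<Sum>j=1..n. over_mahonian n (k - int j))"
proof -
  have fin: "finite (max_places n)"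
    by (rule finite_subset[of _ "{..n} \<times> UNIV"]) (auto simp: max_places_def)
  have "over_mahonian (Suc n) k =
      card (SIGMA (q, b) : max_places n. overlined_perms_inv n (k - int q))"
    using bij_betw_same_card[OF bij_betw_insert_max] by (simp add: over_mahonian_eq_card)
  also have "\<dots> = (\<Sum>(q, b)\<in>max_places n. over_mahonian n (k - int q))"
    using fin finite_overlined_perms[of n]
    by (subst card_SigmaI)
       (auto simp: overlined_perms_inv_def over_mahonian_eq_card intro!: sum.cong)
  finally show ?thesis using sum_max_places[of "\<lambda>q. over_mahonian n (k - int q)" n] by simp
qed

lemma over_mahonian_neg: "k < 0 \<Longrightarrow> over_mahonian n k = 0"
  by (auto simp: over_mahonian_def)

lemma over_mahonian_at_0: "over_mahonian n 0 = 1"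
proof (induction n)
  case 0
  show ?case by (simp add: over_mahonian_0)
next
  case (Suc n)
  then show ?case by (simp add: over_mahonian_Suc over_mahonian_neg)
qed

lemma over_mahonian_eq_0_above:
  assumes "k > int (n choose 2)"
  shows "over_mahonian n k = 0"
  using assms
proof (induction n arbitrary: k)
  case 0
  then show ?case by (simp add: over_mahonian_0)
next
  case (Suc n)
  have "Suc n choose 2 = n + (n choose 2)" by (simp add: numeral_2_eq_2)
  with Suc.prems have "k - int j > int (n choose 2)" if "j \<le> n" for j
    using that by simp
  from Suc.IH[OF this] Suc.IH[OF this[of 0]] show ?case
    by (simp add: over_mahonian_Suc)
qed

theorem theorem2p7:
  "(\<forall>(n::nat) (k::int). n \<ge> 1 \<and> k \<ge> 1 \<longrightarrow>
      over_mahonian n k =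
        over_mahonian (n - 1) k + 2 * (\<Sum>j=1..n-1. over_mahonian (n - 1) (k - int j))) \<and>
   (\<forall>n. over_mahonian n 0 = 1) \<and>
   (\<forall>n k. \<not> (0 \<le> k \<and> k \<le> int (n choose 2)) \<longrightarrow> over_mahonian n k = 0)"
proof (intro conjI allI impI)
  fix n :: nat and k :: int
  assume "n \<ge> 1 \<and> k \<ge> 1"
  then show "over_mahonian n k =
      over_mahonian (n - 1) k + 2 * (\<Sum>j=1..n-1. over_mahonian (n - 1) (k - int j))"
    using over_mahonian_Suc[of "n - 1" k] by simp
next
  fix n :: nat
  show "over_mahonian n 0 = 1" by (rule over_mahonian_at_0)
next
  fix n :: nat and k :: int
  assume "\<not> (0 \<le> k \<and> k \<le> int (n choose 2))"
  then show "over_mahonian n k = 0"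
    using over_mahonian_neg over_mahonian_eq_0_above by (meson not_le)
qed

end
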